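(* Let $r$ be an odd positive integer and let $f:\mathbb{R}\to\mathbb{R}$ be an $(r+1)$-times differentiable function such that $f^{(r+1)}$ is continuous, nonnegative, and has finitely many zeros in $\mathbb{R}$. In addition, assume that there exist $T>0$ and $m>0$ such that $f^{(r+1)}(x)\geq m$ for all $x$ with $|x|>T$. Let $P=(s,t)$ be a point in the plane with $t<f(s)$. Then there are exactly two distinct Taylor polynomials of order $r$ to $f$ which pass through $P$; that is, the set of polynomials $\{P_c : c\in\mathbb{R},\ P_c(s)=t\}$ has exactly two elements.
   Context: For $c\in\mathbb{R}$, $P_c$ denotes the Taylor polynomial of $f$ of order $r$ at $x=c$: $P_c(x)=\sum_{k=0}^{r}\frac{f^{(k)}(c)}{k!}(x-c)^k$. It passes through the point $P=(s,t)$ if $P_c(s)=t$. Taylor polynomials are counted as distinct polynomials. *)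

theory Defs
  imports "HOL-Analysis.Analysis" "HOL-Computational_Algebra.Polynomial"
begin

text \<open>
  \<open>(deriv ^^ k) f\<close> is the \<open>k\<close>-th derivative of \<open>f\<close>. Since \<^const>\<open>deriv\<close> is total, that these
  derivatives exist has to be stated separately.
\<close>

definition times_differentiable :: "nat \<Rightarrow> (real \<Rightarrow> real) \<Rightarrow> bool" where
  "times_differentiable n f \<longleftrightarrow> (\<forall>k<n. \<forall>x. (deriv ^^ k) f differentiable at x)"

definition taylor_poly :: "(real \<Rightarrow> real) \<Rightarrow> nat \<Rightarrow> real \<Rightarrow> real poly" where
  "taylor_poly f r c = (\<Sum>k=0..r. smult ((deriv ^^ k) f c / fact k) ([:-c, 1:] ^ k))"

end

theory Submission
  imports Defs
begin

text \<open>
  Fix \<open>s\<close> and let the centre vary: put \<open>g c = P\<^sub>c(s)\<close>. Differentiating the Taylor sum in its centre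
  telescopes and leaves a single term,
  \<open>g'(c) = f\<^sup>(\<^sup>r\<^sup>+\<^sup>1\<^sup>)(c) (s - c)\<^sup>r / r!\<close> (lemma \<open>DERIV_taylor_poly_centre\<close>).
  As \<open>r\<close> is odd and \<open>f\<^sup>(\<^sup>r\<^sup>+\<^sup>1\<^sup>)\<close> is nonnegative with finitely many zeros, \<open>g\<close> increases strictly up to
  its maximum \<open>g s = f s\<close> and decreases strictly afterwards. The lower bound \<open>m\<close> near infinity keeps
  \<open>\<bar>g'\<bar>\<close> away from zero there, so \<open>g\<close> tends to minus infinity on both sides. Hence each level
  \<open>t < f s\<close> is attained exactly once on either side of \<open>s\<close> (lemma \<open>ex1_level_left\<close>; the right side
  is its mirror image under \<open>x \<mapsto> -x\<close>).

  The two centres \<open>a < b\<close> found in this way give different polynomials: the same monotonicity, now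
  with \<open>b\<close> in place of \<open>s\<close> as the point of evaluation, gives \<open>P\<^sub>a(b) < P\<^sub>b(b)\<close>.
\<close>

lemma poly_taylor_poly:
  "poly (taylor_poly f r c) x = (\<Sum>k=0..r. (deriv ^^ k) f c / fact k * (x - c) ^ k)"
  unfolding taylor_poly_def by (simp add: poly_sum)

lemma poly_taylor_poly_centre: "poly (taylor_poly f r c) c = f c"
proof -
  have "poly (taylor_poly f r c) c = (\<Sum>k=0..r. if k = 0 then f c else 0)"
    unfolding poly_taylor_poly by (intro sum.cong) auto
  then show ?thesis by simp
qed

text \<open>
  By the product rule, the term of index \<open>k > 0\<close> has derivative \<open>u\<^sub>k - u\<^sub>k\<^sub>-\<^sub>1\<close> in the centre, where
  \<open>u\<^sub>k = f\<^sup>(\<^sup>k\<^sup>+\<^sup>1\<^sup>)(c) (x - c)\<^sup>k / k!\<close>, so that only \<open>u\<^sub>r\<close> survives in the sum.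
\<close>

lemma DERIV_taylor_poly_centre:
  assumes "times_differentiable (r + 1) f"
  shows "((\<lambda>c. poly (taylor_poly f r c) x) has_real_derivative
           (deriv ^^ (r + 1)) f c / fact r * (x - c) ^ r) (at c)"
  using assms
proof (induction r)
  case 0
  then show ?case
    by (simp add: poly_taylor_poly times_differentiable_def DERIV_deriv_iff_real_differentiable)
next
  case (Suc r)
  let ?D = "\<lambda>k. (deriv ^^ k) f"
  have D: "(?D (Suc r) has_real_derivative ?D (Suc r + 1) c) (at c)"
    using Suc.prems[unfolded times_differentiable_def, rule_format, of "Suc r" c]
    by (simp add: DERIV_deriv_iff_real_differentiable)
  have IH: "((\<lambda>c. poly (taylor_poly f r c) x) has_real_derivative
           ?D (Suc r) c / fact r * (x - c) ^ r) (at c)"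
    using Suc by (simp add: times_differentiable_def)
  have split: "(\<lambda>c. poly (taylor_poly f (Suc r) c) x) =
      (\<lambda>c. poly (taylor_poly f r c) x + ?D (Suc r) c * ((x - c) ^ Suc r / fact (Suc r)))"
    unfolding poly_taylor_poly by (simp del: funpow.simps fact_Suc power_Suc)
  have P: "((\<lambda>c. (x - c) ^ Suc r / fact (Suc r)) has_real_derivative
           - ((x - c) ^ r / fact r)) (at c)"
  proof -
    have "((\<lambda>c. (x - c) ^ Suc r) has_real_derivative real (Suc r) * ((x - c) ^ r * (- 1))) (at c)"
      by (rule DERIV_cong[OF DERIV_power[OF DERIV_diff[OF DERIV_const DERIV_ident]]]) simp
    from DERIV_cdivide[OF this, of "fact (Suc r)"] show ?thesis
      by (rule DERIV_cong) (simp add: fact_Suc[of r] del: fact_Suc of_nat_Suc power_Suc)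
  qed
  show ?case
    unfolding split
    by (rule DERIV_cong[OF DERIV_add[OF IH DERIV_mult[OF D P]]])
       (simp del: funpow.simps fact_Suc power_Suc)
qed

text \<open>
  A function with nonnegative derivative that fails to increase strictly is constant on an interval,
  where its derivative then has infinitely many zeros.
\<close>

lemma DERIV_nonneg_finite_zeros_imp_less:
  fixes g g' :: "real \<Rightarrow> real"
  assumes "x < y"
    and deriv: "\<And>z. x \<le> z \<Longrightarrow> z \<le> y \<Longrightarrow> (g has_real_derivative g' z) (at z)"
    and nonneg: "\<And>z. x \<le> z \<Longrightarrow> z \<le> y \<Longrightarrow> 0 \<le> g' z"
    and fin: "finite {z \<in> {x<..<y}. g' z = 0}"
  shows "g x < g y"
proof (rule ccontr)
  assume "\<not> g x < g y"
  have mono: "g u \<le> g v" if "x \<le> u" "u \<le> v" "v \<le> y" for u v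
    by (rule DERIV_nonneg_imp_nondecreasing[OF \<open>u \<le> v\<close>])
       (meson deriv nonneg that order_trans)
  have const: "g z = g x" if "x \<le> z" "z \<le> y" for z
    using mono[of x z] mono[of z y] \<open>\<not> g x < g y\<close> that by linarith
  have "g' z = 0" if z: "z \<in> {x<..<y}" for z
  proof -
    have "(g has_real_derivative 0) (at z)"
    proof (rule has_field_derivative_transform_within_open[OF _ open_greaterThanLessThan z])
      show "((\<lambda>_. g x) has_real_derivative 0) (at z)" by (rule DERIV_const)
      show "g x = g w" if "w \<in> {x<..<y}" for w
        using const[of w] that by simp
    qed
    with deriv[of z] z show ?thesis by (auto intro: DERIV_unique)
  qed
  then have "{z \<in> {x<..<y}. g' z = 0} = {x<..<y}" by auto
  with fin infinite_Ioo[OF \<open>x < y\<close>] show False by metis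
qed

text \<open>
  The derivative in the centre has the form assumed here, with \<open>E = f\<^sup>(\<^sup>r\<^sup>+\<^sup>1\<^sup>)\<close> and \<open>u\<close> the point of
  evaluation. Leaving \<open>E\<close> and \<open>u\<close> free makes the two statements that follow apply to the reflected
  situation as well.
\<close>

lemma less_left_of_point:
  fixes h E :: "real \<Rightarrow> real"
  assumes deriv: "\<And>x. (h has_real_derivative E x / fact r * (u - x) ^ r) (at x)"
    and nonneg: "\<And>x. 0 \<le> E x"
    and fin: "finite {x. E x = 0}"
    and "x < y" "y \<le> u"
  shows "h x < h y"
proof (rule DERIV_nonneg_finite_zeros_imp_less[OF \<open>x < y\<close>])
  show "(h has_real_derivative E z / fact r * (u - z) ^ r) (at z)" for z
    by (rule deriv)
  show "0 \<le> E z / fact r * (u - z) ^ r" if "z \<le> y" for z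
    using nonneg[of z] that \<open>y \<le> u\<close> by simp
  show "finite {z \<in> {x<..<y}. E z / fact r * (u - z) ^ r = 0}"
    by (rule finite_subset[OF _ fin]) (use \<open>y \<le> u\<close> in auto)
qed

text \<open>
  Left of both \<open>B\<close> and \<open>u - 1\<close> the factor \<open>(u - x)\<^sup>r\<close> is at least \<open>1\<close>, so the slope of \<open>h\<close> is at
  least \<open>m / r!\<close> and \<open>h\<close> falls below \<open>t\<close> far enough to the left; the intermediate value theorem and
  strict monotonicity then give existence and uniqueness.
\<close>

lemma ex1_level_left:
  fixes h E :: "real \<Rightarrow> real"
  assumes deriv: "\<And>x. (h has_real_derivative E x / fact r * (u - x) ^ r) (at x)"
    and nonneg: "\<And>x. 0 \<le> E x"
    and fin: "finite {x. E x = 0}"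
    and "0 < m" and far: "\<And>x. x < B \<Longrightarrow> m \<le> E x"
    and "t < h u"
  shows "\<exists>!a. a < u \<and> h a = t"
proof -
  note less = less_left_of_point[OF deriv nonneg fin]
  define \<kappa> where "\<kappa> = m / fact r"
  have "0 < \<kappa>" using \<open>0 < m\<close> by (simp add: \<kappa>_def)
  define C where "C = min B (u - 1)"
  \<comment> \<open>to the left of \<open>C\<close> the slope is at least \<open>\<kappa>\<close>, so this step left of \<open>C\<close> brings \<open>h\<close> below \<open>t\<close>\<close>
  define x where "x = C - (\<bar>h C - t\<bar> / \<kappa> + 1)"
  have "x < C" using divide_nonneg_pos[OF abs_ge_zero \<open>0 < \<kappa>\<close>, of "h C - t"] by (simp add: x_def)
  obtain z where z: "x < z" "z < C" "h C - h x = (C - x) * (E z / fact r * (u - z) ^ r)"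
    using MVT2[OF \<open>x < C\<close>, of h "\<lambda>z. E z / fact r * (u - z) ^ r"] deriv by blast
  have "\<kappa> * 1 \<le> E z / fact r * (u - z) ^ r"
  proof (rule mult_mono)
    show "\<kappa> \<le> E z / fact r"
      using far[of z] z by (simp add: \<kappa>_def C_def divide_right_mono)
    show "1 \<le> (u - z) ^ r"
      using z by (intro one_le_power) (simp add: C_def)
  qed (use nonneg[of z] in auto)
  then have "(C - x) * \<kappa> \<le> h C - h x"
    unfolding z(3) using \<open>x < C\<close> by (intro mult_left_mono) auto
  moreover have "(C - x) * \<kappa> = \<bar>h C - t\<bar> + \<kappa>"
    using \<open>0 < \<kappa>\<close> by (simp add: x_def distrib_right)
  ultimately have "h x < t" using \<open>0 < \<kappa>\<close> by linarith
  have "x < u" using \<open>x < C\<close> by (simp add: C_def)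
  have "isCont h y" for y
    by (rule DERIV_isCont[OF deriv])
  then obtain a where "x \<le> a" "a \<le> u" "h a = t"
    using IVT[of h x t u] \<open>h x < t\<close> \<open>t < h u\<close> \<open>x < u\<close> by force
  moreover have "a < u"
    using \<open>a \<le> u\<close> \<open>h a = t\<close> \<open>t < h u\<close> by (cases "a = u") auto
  moreover have "b = a" if "b < u" "h b = t" for b
    using less[of a b] less[of b a] that \<open>h a = t\<close> \<open>a \<le> u\<close> by linarith
  ultimately show ?thesis by blast
qed

theorem theorem3:
  fixes f :: "real \<Rightarrow> real" and r :: nat and s t :: real
  assumes "odd r"
    and "times_differentiable (r + 1) f"
    and "continuous_on UNIV ((deriv ^^ (r + 1)) f)"
    and "\<forall>x. (deriv ^^ (r + 1)) f x \<ge> 0"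
    and "finite {x. (deriv ^^ (r + 1)) f x = 0}"
    and "\<exists>T>0. \<exists>m>0. \<forall>x. \<bar>x\<bar> > T \<longrightarrow> (deriv ^^ (r + 1)) f x \<ge> m"
    and "t < f s"
  shows "card {taylor_poly f r c | c. poly (taylor_poly f r c) s = t} = 2"
proof -
  define E where "E = (deriv ^^ (r + 1)) f"
  define g where "g = (\<lambda>x c. poly (taylor_poly f r c) x)"
  have deriv: "(g x has_real_derivative E c / fact r * (x - c) ^ r) (at c)" for x c
    unfolding g_def E_def by (rule DERIV_taylor_poly_centre[OF assms(2)])
  have nonneg: "0 \<le> E x" for x
    using assms(4) by (simp add: E_def)
  have fin: "finite {x. E x = 0}"
    using assms(5) by (simp add: E_def)
  obtain T m where "m > 0" and far: "\<And>x. T < \<bar>x\<bar> \<Longrightarrow> m \<le> E x"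
    using assms(6) unfolding E_def by blast
  have diag: "g x x = f x" for x
    by (simp add: g_def poly_taylor_poly_centre)

  have "\<exists>!a. a < s \<and> g s a = t"
    by (rule ex1_level_left[OF deriv[of s] nonneg fin \<open>m > 0\<close>, where B = "-T"])
       (use far assms(7) diag in auto)
  then obtain a where a: "a < s" "g s a = t" and a_unique: "\<And>c. c < s \<Longrightarrow> g s c = t \<Longrightarrow> c = a"
    by blast

  have "\<exists>!b. b < - s \<and> g s (- b) = t"
  proof (rule ex1_level_left[where E = "\<lambda>x. E (- x)" and B = "-T"])
    fix x
    \<comment> \<open>the sign from the chain rule is absorbed by the odd power\<close>
    have "- ((s - - x) ^ r) = (- s - x) ^ r"
      using power_minus_odd[OF assms(1), of "s + x"] by simp
    then have "- (E (- x) / fact r * (s - - x) ^ r) = E (- x) / fact r * (- s - x) ^ r"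
      by (metis mult_minus_right)
    with DERIV_mirror[THEN iffD1, OF deriv[of s "- x"]]
    show "((\<lambda>b. g s (- b)) has_real_derivative E (- x) / fact r * (- s - x) ^ r) (at x)"
      by (rule DERIV_cong)
  next
    show "finite {x. E (- x) = 0}"
      using finite_vimageI[OF fin inj_uminus] by (simp add: vimage_def)
  qed (use far nonneg \<open>m > 0\<close> assms(7) diag in auto)
  then obtain b' where b': "b' < - s" "g s (- b') = t"
    and b'_unique: "\<And>c. c < - s \<Longrightarrow> g s (- c) = t \<Longrightarrow> c = b'"
    by blast
  define b where "b = - b'"
  have b: "s < b" "g s b = t" using b' by (auto simp: b_def)
  have b_unique: "c = b" if "s < c" "g s c = t" for c
    using b'_unique[of "- c"] that by (simp add: b_def)

  have "g s c = t \<longleftrightarrow> c = a \<or> c = b" for c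
    using a b a_unique[of c] b_unique[of c] diag[of s] assms(7)
    by (cases c s rule: linorder_cases) auto
  then have "{taylor_poly f r c | c. poly (taylor_poly f r c) s = t} =
      {taylor_poly f r a, taylor_poly f r b}"
    by (auto simp: g_def)
  moreover have "g b a < g b b"
    by (rule less_left_of_point[OF deriv[of b] nonneg fin]) (use a b in auto)
  then have "taylor_poly f r a \<noteq> taylor_poly f r b"
    by (auto simp: g_def)
  ultimately show ?thesis by simp
qed

end
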